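(* Let $D=\sum_{l=0}^{\infty}D_lt^l\in\operatorname{GL}_n(\mathcal{O}_{|\cdot|}[[t]])$ (with $D_l\in \operatorname{M}_n(\mathcal{O}_{|\cdot|})$) be such that there exists a $\delta<1$ with $\|D_l\|\leq\delta^l$ for all $l\in\mathbb{N}$. Then there exists a fundamental matrix $Y\in\operatorname{GL}_n(L)$ for $D$, i.e., $D\phi_q(Y)=Y$. More precisely, $Y$ can be chosen as $Y=\sum_{l=0}^{\infty}Y_lt^l\in\operatorname{GL}_n(\mathcal{O}_{|\cdot|}[[t]])$ with $Y_l\in\operatorname{M}_n(\mathcal{O}_{|\cdot|})$ satisfying $\|Y_l\|\leq\delta^l$ for all $l\in\mathbb{N}$.
   Context: $q$ is a power of a prime. $k$ is a field containing $\mathbb{F}_q$ with a fixed non-trivial non-archimedean absolute value $|\cdot|$. $K$ is the completion of an algebraic closure of the completion of $k$ with respect to $|\cdot|$ (so $K$ is complete and algebraically closed). $\mathcal{O}_{|\cdot|}=\{x\in K: |x|\le 1\}$ is its valuation ring. $K\{t\}=\{\sum_{i\ge0}\alpha_it^i\in K[[t]] : |\alpha_i|\to0\}$ and $L=\operatorname{Quot}(K\{t\})$ is its field of fractions. The endomorphism $\phi_q$ of $K((t))$ raises the coefficients of a Laurent series to the $q$-th power and fixes $t$; it restricts to $L\subseteq K((t))$ and is applied entrywise to matrices. $\operatorname{M}_n$ denotes $n\times n$-matrices and $\|\cdot\|$ is the maximum norm of the entries: $\|(a_{ij})\|=\max|a_{ij}|$. Here $\mathbb{N}$ includes $0$. 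*)

theory Defs
  imports
    "HOL-Analysis.Analysis"
    "HOL-Number_Theory.Prime_Powers"
    "HOL-Computational_Algebra.Formal_Laurent_Series"
begin

definition is_subfield :: "'a::field set \<Rightarrow> bool" where
  "is_subfield F \<longleftrightarrow> 1 \<in> F \<and> (\<forall>x\<in>F. \<forall>y\<in>F. x - y \<in> F \<and> x * y \<in> F) \<and> (\<forall>x\<in>F. inverse x \<in> F)"

definition field_embedding :: "('a::field \<Rightarrow> 'b::field) \<Rightarrow> bool" where
  "field_embedding \<iota> \<longleftrightarrow>
     \<iota> 1 = 1 \<and> (\<forall>x y. \<iota> (x + y) = \<iota> x + \<iota> y) \<and> (\<forall>x y. \<iota> (x * y) = \<iota> x * \<iota> y)"

definition nonarch_abs :: "('a::field \<Rightarrow> real) \<Rightarrow> bool" where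
  "nonarch_abs v \<longleftrightarrow>
     (\<forall>x. 0 \<le> v x) \<and> (\<forall>x. v x = 0 \<longleftrightarrow> x = 0) \<and>
     (\<forall>x y. v (x * y) = v x * v y) \<and> (\<forall>x y. v (x + y) \<le> max (v x) (v y))"

definition nontrivial_abs :: "('a::field \<Rightarrow> real) \<Rightarrow> bool" where
  "nontrivial_abs v \<longleftrightarrow> (\<exists>x. x \<noteq> 0 \<and> v x \<noteq> 1)"

definition extends_abs :: "('a::field \<Rightarrow> 'b::field) \<Rightarrow> ('a \<Rightarrow> real) \<Rightarrow> ('b \<Rightarrow> real) \<Rightarrow> bool" where
  "extends_abs \<iota> v w \<longleftrightarrow> (\<forall>x. w (\<iota> x) = v x)"

definition abs_dist :: "('a::field \<Rightarrow> real) \<Rightarrow> 'a \<Rightarrow> 'a \<Rightarrow> real" where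
  "abs_dist v x y = v (x - y)"

definition is_completion ::
  "('a::field \<Rightarrow> 'b::field) \<Rightarrow> ('a \<Rightarrow> real) \<Rightarrow> ('b \<Rightarrow> real) \<Rightarrow> bool" where
  "is_completion \<iota> v w \<longleftrightarrow>
     field_embedding \<iota> \<and> nonarch_abs w \<and> extends_abs \<iota> v w \<and>
     Metric_space.mcomplete UNIV (abs_dist w) \<and>
     Metric_space.mtopology UNIV (abs_dist w) closure_of range \<iota> = UNIV"

definition is_algebraic_closure :: "('a::field \<Rightarrow> 'b::alg_closed_field) \<Rightarrow> bool" where
  "is_algebraic_closure \<iota> \<longleftrightarrow>
     field_embedding \<iota> \<and> (\<forall>x. \<exists>p. p \<noteq> 0 \<and> poly (map_poly \<iota> p) x = 0)"

text \<open>
  The tower: \<open>k\<^sub>1\<close> is the completion of \<open>k\<close>, \<open>k\<^sub>2\<close> an algebraic closure of \<open>k\<^sub>1\<close>, and \<open>K\<close> the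
  completion of \<open>k\<^sub>2\<close>. Each of the fields carries its own function for the one absolute value.
  That \<open>K\<close> is again algebraically closed is a consequence, not part of the definition.
\<close>

definition completed_algebraic_closure ::
  "('k::field \<Rightarrow> 'k1::field) \<Rightarrow> ('k1 \<Rightarrow> 'k2::alg_closed_field) \<Rightarrow> ('k2 \<Rightarrow> 'K::field) \<Rightarrow>
   ('k \<Rightarrow> real) \<Rightarrow> ('k1 \<Rightarrow> real) \<Rightarrow> ('k2 \<Rightarrow> real) \<Rightarrow> ('K \<Rightarrow> real) \<Rightarrow> bool" where
  "completed_algebraic_closure \<iota>\<^sub>1 \<iota>\<^sub>2 \<iota>\<^sub>3 v v\<^sub>1 v\<^sub>2 w \<longleftrightarrow>
     is_completion \<iota>\<^sub>1 v v\<^sub>1 \<and>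
     is_algebraic_closure \<iota>\<^sub>2 \<and> nonarch_abs v\<^sub>2 \<and> extends_abs \<iota>\<^sub>2 v\<^sub>1 v\<^sub>2 \<and>
     is_completion \<iota>\<^sub>3 v\<^sub>2 w"

definition valuation_ring :: "('a::field \<Rightarrow> real) \<Rightarrow> 'a set" where
  "valuation_ring v = {x. v x \<le> 1}"

definition fps_over :: "'a::zero set \<Rightarrow> 'a fps set" where
  "fps_over R = {f. \<forall>i. fps_nth f i \<in> R}"

definition tate_algebra :: "('a::field \<Rightarrow> real) \<Rightarrow> 'a fps set" where
  "tate_algebra v = {f. (\<lambda>i. v (fps_nth f i)) \<longlonglongrightarrow> 0}"

text \<open>\<open>L = Quot(K{t})\<close>, realised as the set of fractions inside the field \<open>K((t))\<close>.\<close>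

definition tate_quot :: "('a::field \<Rightarrow> real) \<Rightarrow> 'a fls set" where
  "tate_quot v = {fps_to_fls f / fps_to_fls g | f g. f \<in> tate_algebra v \<and> g \<in> tate_algebra v \<and> g \<noteq> 0}"

definition phi :: "nat \<Rightarrow> 'a::field fls \<Rightarrow> 'a fls" where
  "phi q f = Abs_fls (\<lambda>n. fls_nth f n ^ q)"

lemma fls_nth_phi:
  assumes "q > 0"
  shows "fls_nth (phi q f) n = fls_nth f n ^ q"
proof -
  have "\<forall>\<^sub>\<infinity>n. fls_nth f (- int n) ^ q = 0"
    using fls_nth[of f] assms by (auto elim!: MOST_mono)
  thus ?thesis
    unfolding phi_def by simp
qed

text \<open>\<open>GL\<^sub>n(R)\<close> for a subring \<open>R\<close> of the coefficient ring: the inverse must have entries in \<open>R\<close>, too.\<close>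

definition GL :: "'a::semiring_1 set \<Rightarrow> ('a^'n^'n) set" where
  "GL R = {A. (\<forall>i j. A $ i $ j \<in> R) \<and>
              (\<exists>B. (\<forall>i j. B $ i $ j \<in> R) \<and> A ** B = mat 1 \<and> B ** A = mat 1)}"

definition max_norm :: "('a \<Rightarrow> real) \<Rightarrow> 'a^'n^'m \<Rightarrow> real" where
  "max_norm v A = Max {v (A $ i $ j) | i j. True}"

text \<open>The matrix \<open>D\<^sub>l\<close> in \<open>D = \<Sum>\<^sub>l D\<^sub>l t\<^sup>l\<close>.\<close>

definition mat_coeff :: "'a fps^'n^'m \<Rightarrow> nat \<Rightarrow> 'a^'n^'m" where
  "mat_coeff D l = map_matrix (\<lambda>f. fps_nth f l) D"

definition fundamental_matrix ::
  "('a::field \<Rightarrow> real) \<Rightarrow> nat \<Rightarrow> 'a fls^'n^'n \<Rightarrow> 'a fls^'n^'n \<Rightarrow> bool" where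
  "fundamental_matrix v q D Y \<longleftrightarrow> Y \<in> GL (tate_quot v) \<and> D ** map_matrix (phi q) Y = Y"

end

theory Submission
  imports Defs
begin

text \<open>
  Over an algebraically closed field, every vector lies in the span of the fixed vectors of
  \<open>x \<mapsto> A \<phi>(x)\<close>, for invertible \<open>A\<close> and \<open>\<phi>\<close> the \<open>q\<close>-power map (Lang); if \<open>A\<close> is invertible over the
  valuation ring, so is any matrix whose columns are independent fixed vectors. Instead of using that
  \<open>K\<close> is algebraically closed, approximate \<open>D\<^sub>0\<close> over the dense subfield \<open>k\<^sub>2\<close>, solve there, and correct
  the solution by a matrix \<open>U\<close> close to \<open>1\<close>: if \<open>\<parallel>A\<parallel> \<le> 1\<close> and \<open>\<parallel>B\<parallel> < 1\<close>, then \<open>U = A \<phi>(U) + B\<close> is solved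
  by iteration, as \<open>\<phi>\<close> contracts the open unit ball. The same iteration solves the equations
  \<open>Y\<^sub>l = D\<^sub>0 \<phi>(Y\<^sub>l) + \<Sum>\<^sub>i\<^sub>>\<^sub>0 D\<^sub>i \<phi>(Y\<^bsub>l-i\<^esub>)\<close> one after the other, with \<open>\<parallel>Y\<^sub>l\<parallel> \<le> \<delta>\<^sup>l\<close>. The series with
  \<open>|f\<^sub>l| \<le> \<delta>\<^sup>l\<close> form a ring in which \<open>det Y\<close> is a unit, so \<open>Y\<close> is invertible over it by Cramer's rule.
\<close>

subsection \<open>Ring homomorphisms and the Frobenius map\<close>

locale unital_ring_hom =
  fixes h :: "'a::comm_ring_1 \<Rightarrow> 'b::comm_ring_1"
  assumes hom_1: "h 1 = 1"
    and hom_add: "h (x + y) = h x + h y"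
    and hom_mult: "h (x * y) = h x * h y"
begin

lemma hom_0: "h 0 = 0"
  using hom_add[of 0 0] by simp

lemma hom_minus: "h (- x) = - h x"
  using hom_add[of x "- x"] by (simp add: hom_0 eq_neg_iff_add_eq_0 add.commute)

lemma hom_diff: "h (x - y) = h x - h y"
  using hom_add[of x "- y"] by (simp add: hom_minus)

lemma hom_sum: "h (sum g S) = (\<Sum>x\<in>S. h (g x))"
  by (induction S rule: infinite_finite_induct) (auto simp: hom_0 hom_add)

lemma hom_prod: "h (prod g S) = (\<Prod>x\<in>S. h (g x))"
  by (induction S rule: infinite_finite_induct) (auto simp: hom_1 hom_mult)

lemma hom_of_nat: "h (of_nat n) = of_nat n"
  by (induction n) (auto simp: hom_0 hom_1 hom_add)

lemma hom_of_int: "h (of_int n) = of_int n"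
  by (cases n) (auto simp: hom_of_nat hom_minus hom_diff hom_1)

lemma hom_det: "h (det A) = det (map_matrix h A)"
  by (simp add: det_def hom_sum hom_mult hom_prod hom_of_int)

lemma hom_matrix_mult: "map_matrix h (A ** B) = map_matrix h A ** map_matrix h B"
  by (simp add: vec_eq_iff matrix_matrix_mult_def hom_sum hom_mult)

lemma hom_matrix_add: "map_matrix h (A + B) = map_matrix h A + map_matrix h B"
  by (simp add: vec_eq_iff hom_add)

lemma hom_mat_1: "map_matrix h (mat 1) = mat 1"
  by (simp add: vec_eq_iff mat_def hom_0 hom_1)

end

lemma field_embedding_imp_hom: "field_embedding \<iota> \<Longrightarrow> unital_ring_hom \<iota>"
  by (simp add: field_embedding_def unital_ring_hom_def)


text \<open>Translation by 1 permutes the set, so the sum of its elements equals itself plus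
  \<open>card F\<close> copies of 1.\<close>

lemma of_nat_card_subfield:
  fixes F :: "'a::field set"
  assumes F: "is_subfield F" and "card F > 0"
  shows "of_nat (card F) = (0::'a)"
proof -
  have diff: "x - y \<in> F" if "x \<in> F" "y \<in> F" for x y
    using F that by (auto simp: is_subfield_def)
  have one: "1 \<in> F" using F by (simp add: is_subfield_def)
  have add: "x + 1 \<in> F" if "x \<in> F" for x
  proof -
    \<comment> \<open>\<open>is_subfield\<close> gives closure under differences, so x + 1 is
      written as x - (0 - 1).\<close>
    have "x - ((1 - 1) - 1) \<in> F" by (intro diff that one)
    then show ?thesis by simp
  qed
  have "bij_betw (\<lambda>x. x + 1) F F"
    by (rule bij_betw_byWitness[where f' = "\<lambda>x. x - 1"]) (auto intro: add diff one)
  then have "(\<Sum>x\<in>F. x) = (\<Sum>x\<in>F. x + 1)"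
    by (rule sum.reindex_bij_betw[symmetric])
  then show ?thesis by (simp add: sum.distrib)
qed

text \<open>If q = p^k vanishes in a field, the characteristic is p, and the map is the k-fold
  iterate of the Frobenius endomorphism.\<close>

lemma primepow_power_hom:
  assumes q: "primepow q" and 0: "of_nat q = (0::'a::field)"
  shows "unital_ring_hom (\<lambda>x::'a. x ^ q)"
proof -
  obtain p k where pk: "prime p" "q = p ^ k"
    using q by (auto simp: primepow_def)
  have "of_nat p ^ k = (0::'a)" using 0 pk by simp
  then have "of_nat p = (0::'a)" by simp
  then have "CHAR('a) dvd p" by (simp add: of_nat_eq_0_iff_char_dvd)
  then have "CHAR('a) = p"
    using pk(1) CHAR_not_1' by (metis prime_nat_iff One_nat_def)
  then show ?thesis
    using pk by unfold_locales (auto simp: freshmans_dream' power_mult_distrib)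
qed

subsection \<open>Lang's theorem\<close>

text \<open>An Artin-Schreier equation; its solutions turn a vector fixed modulo a span of fixed
  vectors into a fixed vector.\<close>

lemma exists_power_eq_add:
  fixes c :: "'a::alg_closed_field"
  assumes "q > 1"
  shows "\<exists>x. x ^ q = x + c"
proof -
  let ?p = "monom 1 q - [:c, 1:] :: 'a poly"
  have "degree ?p = q"
  proof (rule antisym)
    show "degree ?p \<le> q" using assms by (intro degree_diff_le) (auto simp: degree_monom_eq)
    show "degree ?p \<ge> q" using assms
      by (intro le_degree) (auto simp: coeff_pCons split: nat.splits)
  qed
  then obtain x where "poly ?p x = 0"
    using alg_closed_imp_poly_has_root[of ?p] assms by auto
  then show ?thesis by (intro exI[of _ x]) (simp add: poly_monom algebra_simps)
qed

text \<open>
  If \<open>f\<^bsup>m+1\<^esup> v = \<Sum>\<^bsub>i\<le>m\<^esub> a\<^sub>i f\<^sup>i v\<close> for a \<open>q\<close>-semilinear \<open>f\<close>, then \<open>\<Sum>\<^bsub>i\<le>m\<^esub> b\<^sub>i f\<^sup>i v\<close> is fixed by \<open>f\<close> if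
  \<open>b\<^sub>0 = a\<^sub>0 b\<^sub>m\<^sup>q\<close> and \<open>b\<^bsub>i+1\<^esub> = b\<^sub>i\<^sup>q + a\<^bsub>i+1\<^esub> b\<^sub>m\<^sup>q\<close>. The polynomial \<open>twisted_poly q a i\<close> expresses \<open>b\<^sub>i\<close>
  in terms of \<open>b\<^sub>m\<close>.
\<close>

primrec twisted_poly :: "nat \<Rightarrow> (nat \<Rightarrow> 'a::idom) \<Rightarrow> nat \<Rightarrow> 'a poly" where
  "twisted_poly q a 0 = monom (a 0) q"
| "twisted_poly q a (Suc i) = twisted_poly q a i ^ q + monom (a (Suc i)) q"

text \<open>The condition on b_m is P_m(X) = X, which always has the root 0. A factor X^2 of P_m
  gives P_m - X = X (X Q - 1), and the roots of the second factor are nonzero.\<close>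

lemma X2_dvd_twisted_poly:
  assumes "q > 1"
  shows "monom 1 2 dvd twisted_poly q a i"
proof (induction i)
  have *: "monom 1 2 dvd monom c q" for c :: 'a
    using assms by (intro dvdI[of _ _ "monom c (q - 2)"]) (simp add: mult_monom del: add_2_eq_Suc)
  case 0 then show ?case by (simp add: *)
  case (Suc i)
  have "twisted_poly q a i dvd twisted_poly q a i ^ q" using assms by simp
  with Suc show ?case by (auto intro: * dvd_add dvd_trans)
qed

text \<open>A nonzero P_i has degree at least 2, being divisible by X^2. So P_i^q has degree at
  least 2q, and a monomial of degree at most q cannot cancel it.\<close>

lemma twisted_poly_nonzero:
  assumes "q > 1" "j \<le> i" "a j \<noteq> 0"
  shows "twisted_poly q a i \<noteq> 0 \<and> degree (twisted_poly q a i) \<ge> q"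
  using assms(2)
proof (induction i)
  case 0
  with assms show ?case by (simp add: degree_monom_eq monom_eq_0_iff)
next
  case (Suc i)
  let ?P = "twisted_poly q a i"
  show ?case
  proof (cases "?P = 0")
    case True
    \<comment> \<open>By the induction hypothesis, j <= i would make \<open>?P\<close>
      nonzero.\<close>
    with Suc have "j = Suc i" by (auto simp: le_Suc_eq)
    with True assms show ?thesis by (simp add: degree_monom_eq monom_eq_0_iff power_0_left)
  next
    case False
    have "monom 1 2 dvd ?P" using X2_dvd_twisted_poly assms by blast
    then have "degree (monom (1::'a) 2) \<le> degree ?P" using False by (rule dvd_imp_degree_le)
    then have "degree ?P \<ge> 2" by (simp add: degree_monom_eq)
    then have "degree (?P ^ q) > q" using False assms by (simp add: degree_power_eq)
    moreover have "degree (monom (a (Suc i)) q) \<le> q" by (rule degree_monom_le)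
    ultimately have "degree (twisted_poly q a (Suc i)) = degree (?P ^ q)" "degree (?P ^ q) > q"
      by (simp_all add: degree_add_eq_left)
    then show ?thesis using assms by auto
  qed
qed

lemma exists_cyclic_coefficients:
  fixes a :: "nat \<Rightarrow> 'a::alg_closed_field"
  assumes "q > 1" "j \<le> m" "a j \<noteq> 0"
  shows "\<exists>b. b m \<noteq> 0 \<and> b 0 = a 0 * b m ^ q \<and> (\<forall>i<m. b (Suc i) = b i ^ q + a (Suc i) * b m ^ q)"
proof -
  let ?P = "twisted_poly q a"
  obtain Q where Q: "?P m = monom 1 2 * Q"
    using X2_dvd_twisted_poly[OF assms(1)] by blast
  have "Q \<noteq> 0" using twisted_poly_nonzero[of q j m a] Q assms by auto
  then have "degree ([:0, 1:] * Q - 1) > 0"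
    using degree_add_eq_left[of "-1" "[:0, 1:] * Q"]
    by (simp add: degree_mult_eq)
  then obtain \<beta> where "poly ([:0, 1:] * Q - 1) \<beta> = 0"
    using alg_closed_imp_poly_has_root by blast
  then have \<beta>: "\<beta> * poly Q \<beta> = 1" by simp
  then have "\<beta> \<noteq> 0" by auto
  \<comment> \<open>As \<beta> is a fixed point of P_m, the values P_i(\<beta>) satisfy the
    recursion with b_m = \<beta>.\<close>
  have top: "poly (?P m) \<beta> = \<beta>"
    using \<beta> by (simp add: Q poly_monom power2_eq_square mult.assoc)
  show ?thesis
    using \<open>\<beta> \<noteq> 0\<close> by (intro exI[of _ "\<lambda>i. poly (?P i) \<beta>"]) (simp add: top poly_monom)
qed

text \<open>More vectors than the dimension are dependent; the relation is cut off at its last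
  nonzero coefficient. Since \<open>vec.dependent\<close> speaks of sets, repeated vectors form a
  separate case.\<close>

lemma exists_linear_relation:
  fixes g :: "nat \<Rightarrow> 'a::field^'n"
  shows "\<exists>a m. a m \<noteq> 0 \<and> (\<Sum>i\<le>m. a i *s g i) = 0"
proof (cases "inj_on g {..CARD('n)}")
  case True
  let ?S = "g ` {..CARD('n)}"
  have "card ?S > CARD('n)" using True by (simp add: card_image)
  then have "vec.dependent ?S"
    using vec.independent_card_le_dim[of ?S UNIV] vec_dim_card by (metis not_less subset_UNIV)
  then obtain u where u: "(\<Sum>v\<in>?S. u v *s v) = 0" "\<exists>v\<in>?S. u v \<noteq> 0"
    by (auto simp: vec.dependent_finite)
  define N where "N = CARD('n)"
  obtain j where j: "j \<le> N" "u (g j) \<noteq> 0" using u by (auto simp: N_def)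
  define m where "m = Max {i. i \<le> N \<and> u (g i) \<noteq> 0}"
  have fin: "finite {i. i \<le> N \<and> u (g i) \<noteq> 0}" by simp
  have m: "m \<le> N" "u (g m) \<noteq> 0"
    using Max_in[OF fin] j unfolding m_def[symmetric] by auto
  have "u (g i) = 0" if "i \<le> N" "\<not> i \<le> m" for i
    using Max_ge[OF fin, of i] that unfolding m_def[symmetric] by auto
  then have "(\<Sum>i\<le>m. u (g i) *s g i) = (\<Sum>i\<le>N. u (g i) *s g i)"
    using m by (intro sum.mono_neutral_left) auto
  also have "\<dots> = 0"
    using u True by (simp add: sum.reindex N_def)
  finally show ?thesis using m by (intro exI[of _ "\<lambda>i. u (g i)"]) auto
next
  case False
  then obtain i j where ij: "i < j" "g i = g j"
    unfolding inj_on_def by (metis linorder_neqE_nat)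
  have "(\<Sum>l\<le>j. (if l = j then 1 else if l = i then - 1 else 0) *s g l) =
     (\<Sum>l\<in>{i,j}. (if l = j then 1 else if l = i then - 1 else 0) *s g l)"
    using ij by (intro sum.mono_neutral_right) auto
  also have "\<dots> = 0" using ij by simp
  finally show ?thesis
    by (intro exI[of _ "\<lambda>l. if l = j then 1 else if l = i then - 1 else 0"] exI[of _ j]) auto
qed

text \<open>Let W be the span of the fixed vectors. Extracting q-th roots of coefficients shows that
  f is injective modulo W, and solving c^q = c - r shows that a vector fixed modulo W lies in W. A
  vector outside W would nevertheless produce, from its iterates, a nonzero vector fixed modulo
  W.\<close>

lemma span_fixed_points_semilinear:
  fixes f :: "'a::alg_closed_field^'n \<Rightarrow> 'a^'n"
  assumes hom: "unital_ring_hom (\<lambda>x::'a. x ^ q)" and q: "q > 1"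
    and add: "\<And>x y. f (x + y) = f x + f y"
    and scale: "\<And>c x. f (c *s x) = c ^ q *s f x"
    and inj: "\<And>x. f x = 0 \<Longrightarrow> x = 0"
  shows "vec.span {x. f x = x} = UNIV"
proof (rule ccontr)
  let ?W = "vec.span {x. f x = x}"
  interpret frob: unital_ring_hom "\<lambda>x::'a. x ^ q" by (rule hom)
  have f0: "f 0 = 0" using add[of 0 0] by simp
  have fdiff: "f (x - y) = f x - f y" for x y using add[of "x - y" y] by simp
  have fsum: "f (\<Sum>i\<in>I. g i) = (\<Sum>i\<in>I. f (g i))" for I :: "'i set" and g
    by (induction I rule: infinite_finite_induct) (auto simp: f0 add)
  have W_combination: "(\<Sum>a\<in>t. c a *s a) \<in> ?W" if "t \<subseteq> {x. f x = x}" for t c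
    using that by (intro vec.span_sum vec.span_scale vec.span_base) auto
  have W_preimage: "x \<in> ?W" if "f x \<in> ?W" for x
  proof -
    from that obtain t r where t: "t \<subseteq> {x. f x = x}" "f x = (\<Sum>a\<in>t. r a *s a)"
      by (auto simp: vec.span_explicit)
    have "\<forall>a. \<exists>c. c ^ q = r a" using nth_root_exists q by (metis gr_implies_not0 neq0_conv)
    then obtain c where c: "c a ^ q = r a" for a by metis
    have "f (x - (\<Sum>a\<in>t. c a *s a)) = 0"
      using t by (auto simp: fdiff fsum scale c intro!: sum.cong)
    then have "x = (\<Sum>a\<in>t. c a *s a)" using inj by fastforce
    then show ?thesis using W_combination t by simp
  qed
  have W_difference: "x \<in> ?W" if "f x - x \<in> ?W" for x
  proof -
    from that obtain t r where t: "t \<subseteq> {x. f x = x}" "f x - x = (\<Sum>a\<in>t. r a *s a)"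
      by (auto simp: vec.span_explicit)
    have "\<forall>a. \<exists>c. c ^ q = c + - r a" using exists_power_eq_add[OF q] by blast
    then obtain c where c: "c a ^ q = c a - r a" for a by (metis add_uminus_conv_diff)
    have "f (\<Sum>a\<in>t. c a *s a) = (\<Sum>a\<in>t. c a *s a) - (\<Sum>a\<in>t. r a *s a)"
      using t by (auto simp: fsum scale c vector_sub_rdistrib sum_subtractf[symmetric] intro!: sum.cong)
    then have "f (x + (\<Sum>a\<in>t. c a *s a)) = x + (\<Sum>a\<in>t. c a *s a)"
      using t(2) by (simp add: add algebra_simps)
    then have "x + (\<Sum>a\<in>t. c a *s a) \<in> ?W" by (intro vec.span_base) auto
    then show ?thesis using W_combination[OF t(1)] vec.span_add_eq2 by blast
  qed
  assume "?W \<noteq> UNIV"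
  then obtain v where v: "v \<notin> ?W" by auto
  define g where "g i = (f ^^ i) v" for i
  have f_g: "f (g i) = g (Suc i)" for i by (simp add: g_def)
  have g_notin: "g i \<notin> ?W" for i
    by (induction i) (use v W_preimage in \<open>auto simp: g_def\<close>)
  \<comment> \<open>Below, a minimal relation among the iterates yields a vector fixed modulo \<open>?W\<close>; it lifts to
    a fixed vector, hence is itself a shorter relation.\<close>
  define rel where "rel m \<longleftrightarrow> (\<exists>a. a m \<noteq> 0 \<and> (\<Sum>i\<le>m. a i *s g i) \<in> ?W)" for m
  obtain a1 m1 where "a1 m1 \<noteq> 0" "(\<Sum>i\<le>m1. a1 i *s g i) = 0"
    using exists_linear_relation[of g] by blast
  then have "rel m1" unfolding rel_def by (intro exI[of _ a1]) (simp add: vec.span_zero)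
  then obtain M where M: "rel M" "\<And>l. l < M \<Longrightarrow> \<not> rel l"
    using exists_least_iff[of rel] by blast
  then obtain a0 where a0: "a0 M \<noteq> 0" "(\<Sum>i\<le>M. a0 i *s g i) \<in> ?W"
    unfolding rel_def by blast
  have "M \<noteq> 0"
  proof
    assume "M = 0"
    then have "inverse (a0 0) *s (a0 0 *s g 0) \<in> ?W"
      using a0 by (intro vec.span_scale[of "a0 0 *s g 0"]) simp
    moreover have "inverse (a0 0) *s (a0 0 *s g 0) = g 0"
      using a0 \<open>M = 0\<close> by (simp add: vector_smult_assoc)
    ultimately show False using g_notin by metis
  qed
  then obtain m where m: "M = Suc m" by (cases M) auto
  \<comment> \<open>The relation is normalised to express the iterate m + 1 through the earlier
    ones, up to an error \<open>u\<close> in \<open>?W\<close>.\<close>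
  define a where "a i = - (inverse (a0 M) * a0 i)" for i
  define u where "u = g (Suc m) - (\<Sum>i\<le>m. a i *s g i)"
  have "inverse (a0 M) *s (\<Sum>i\<le>M. a0 i *s g i) \<in> ?W"
    using a0 by (intro vec.span_scale)
  also have "inverse (a0 M) *s (\<Sum>i\<le>M. a0 i *s g i) = u"
    using a0 by (simp add: m u_def a_def vector_add_ldistrib vec.scale_sum_right vector_smult_assoc
        sum_negf)
  finally have u: "u \<in> ?W" .
  have "\<exists>j\<le>m. a j \<noteq> 0"
  proof (rule ccontr)
    assume "\<not> ?thesis"
    then have "u = g (Suc m)" by (simp add: u_def)
    then show False using u g_notin by metis
  qed
  then obtain b where b: "b m \<noteq> 0" "b 0 = a 0 * b m ^ q"
      "\<And>i. i < m \<Longrightarrow> b (Suc i) = b i ^ q + a (Suc i) * b m ^ q"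
    using exists_cyclic_coefficients[OF q] by metis
  define x where "x = (\<Sum>i\<le>m. b i *s g i)"
  have "f x = (\<Sum>i\<le>m. b i ^ q *s g (Suc i))"
    by (simp add: x_def fsum scale f_g)
  also have "\<dots> = (\<Sum>i<m. b i ^ q *s g (Suc i)) + b m ^ q *s g (Suc m)"
    by (simp add: lessThan_Suc_atMost[symmetric])
  \<comment> \<open>The top iterate is eliminated by the relation; the recursion for
    \<open>b\<close> then reassembles everything but the multiple of \<open>u\<close> into
    \<open>x\<close>.\<close>
  also have "b m ^ q *s g (Suc m) = b m ^ q *s u + (\<Sum>i\<le>m. (a i * b m ^ q) *s g i)"
    by (simp add: u_def vec.scale_right_diff_distrib vec.scale_sum_right vector_smult_assoc mult.commute)
  also have "(\<Sum>i\<le>m. (a i * b m ^ q) *s g i) =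
      b 0 *s g 0 + (\<Sum>i<m. (a (Suc i) * b m ^ q) *s g (Suc i))"
    by (simp only: sum.atMost_shift b(2))
  finally have "f x = b m ^ q *s u + (b 0 *s g 0 + ((\<Sum>i<m. b i ^ q *s g (Suc i)) +
      (\<Sum>i<m. (a (Suc i) * b m ^ q) *s g (Suc i))))"
    by (simp add: algebra_simps)
  also have "(\<Sum>i<m. b i ^ q *s g (Suc i)) + (\<Sum>i<m. (a (Suc i) * b m ^ q) *s g (Suc i)) =
      (\<Sum>i<m. b (Suc i) *s g (Suc i))"
    by (simp add: sum.distrib[symmetric] b(3) vector_sadd_rdistrib)
  also have "b 0 *s g 0 + (\<Sum>i<m. b (Suc i) *s g (Suc i)) = x"
    by (simp only: x_def sum.atMost_shift)
  finally have "f x - x \<in> ?W" using u by (simp add: vec.span_scale)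
  then have "rel m" using W_difference b(1) unfolding rel_def x_def by blast
  then show False using M m by simp
qed

text \<open>The fixed vectors of the semilinear map attached to A span the space, so they contain a
  basis, which supplies the columns of Y.\<close>

lemma lang_exists:
  fixes A :: "'a::alg_closed_field^'n^'n"
  assumes hom: "unital_ring_hom (\<lambda>x::'a. x ^ q)" and q: "q > 1" and A: "invertible A"
  shows "\<exists>Y :: 'a^'n^'n. invertible Y \<and> A ** map_matrix (\<lambda>x. x ^ q) Y = Y"
proof -
  interpret frob: unital_ring_hom "\<lambda>x::'a. x ^ q" by (rule hom)
  define f where "f x = A *v (\<chi> i. x $ i ^ q)" for x :: "'a^'n"
  define S where "S = {x. f x = x}"
  have "vec.span S = UNIV"
    unfolding S_def using hom q
  proof (rule span_fixed_points_semilinear)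
    show "f (x + y) = f x + f y" for x y
      by (simp add: f_def vec_eq_iff matrix_vector_mult_def frob.hom_add sum.distrib distrib_left)
    show "f (c *s x) = c ^ q *s f x" for c x
      by (simp add: f_def vec_eq_iff matrix_vector_mult_def power_mult_distrib sum_distrib_left mult_ac)
    show "x = 0" if "f x = 0" for x
    proof -
      have "(\<chi> i. x $ i ^ q) = 0"
        using that A unfolding f_def
        by (metis invertible_def matrix_vector_mul_assoc matrix_vector_mul_lid matrix_vector_mult_0_right)
      then show ?thesis using q by (auto simp: vec_eq_iff)
    qed
  qed
  obtain B where B: "B \<subseteq> S" "vec.independent B" "S \<subseteq> vec.span B"
    using vec.maximal_independent_subset by blast
  have span_B: "vec.span B = UNIV"
    using B(3) \<open>vec.span S = UNIV\<close> by (metis vec.span_mono vec.span_span top.extremum_uniqueI)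
  then have "card B = CARD('n)"
    using B(2) by (metis vec.dim_eq_card_independent vec.dim_span vec_dim_card)
  moreover have "finite B" using B(2) by (rule vec.finiteI_independent)
  ultimately obtain c where c: "bij_betw c (UNIV :: 'n set) B"
    by (metis finite_same_card_bij finite)
  define Y where "Y = (\<chi> i j. c j $ i)"
  have "column j Y = c j" for j by (simp add: Y_def column_def vec_eq_iff)
  then have "columns Y = B" using c by (auto simp: columns_def bij_betw_def)
  then have "invertible Y"
    using matrix_right_invertible_span_columns[of Y] span_B by (simp add: invertible_right_inverse)
  moreover have "f (c j) = c j" for j
    using B(1) c by (auto simp: S_def bij_betw_def)
  then have "A ** map_matrix (\<lambda>x. x ^ q) Y = Y"
    by (simp add: f_def vec_eq_iff Y_def matrix_matrix_mult_def matrix_vector_mult_def)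
  ultimately show ?thesis by blast
qed

subsection \<open>Non-archimedean fields\<close>

locale nonarch_field =
  fixes v :: "'a::field \<Rightarrow> real"
  assumes nonarch: "nonarch_abs v"
begin

lemma abs_nonneg: "0 \<le> v x" and abs_eq_0_iff: "v x = 0 \<longleftrightarrow> x = 0"
  and abs_mult: "v (x * y) = v x * v y" and abs_add: "v (x + y) \<le> max (v x) (v y)"
  using nonarch by (auto simp: nonarch_abs_def)

lemma abs_0: "v 0 = 0"
  by (simp add: abs_eq_0_iff)

lemma abs_1: "v 1 = 1"
  using abs_mult[of 1 1] abs_eq_0_iff[of 1] by simp

lemma abs_power: "v (x ^ n) = v x ^ n"
  by (induction n) (auto simp: abs_1 abs_mult)

lemma abs_minus: "v (- x) = v x"
proof -
  have "v (- 1) ^ 2 = 1" using abs_power[of "- 1" 2] by (simp add: abs_1)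
  then have "v (- 1) = 1" using abs_nonneg[of "- 1"] by (simp add: power2_eq_1_iff)
  then show ?thesis using abs_mult[of "- 1" x] by simp
qed

lemma abs_add_le: "v x \<le> r \<Longrightarrow> v y \<le> r \<Longrightarrow> v (x + y) \<le> r"
  using abs_add[of x y] by linarith

lemma abs_diff_le: "v x \<le> r \<Longrightarrow> v y \<le> r \<Longrightarrow> v (x - y) \<le> r"
  using abs_add_le[of x r "- y"] by (simp add: abs_minus)

lemma abs_sum_le: "0 \<le> r \<Longrightarrow> (\<And>i. i \<in> I \<Longrightarrow> v (f i) \<le> r) \<Longrightarrow> v (sum f I) \<le> r"
  by (induction I rule: infinite_finite_induct) (auto simp: abs_0 intro: abs_add_le)

lemma abs_mult_le: "v x \<le> r \<Longrightarrow> v y \<le> s \<Longrightarrow> v (x * y) \<le> r * s"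
  using abs_nonneg[of x] abs_nonneg[of y] by (simp add: abs_mult mult_mono)

lemma abs_mult_le_right: "v x \<le> 1 \<Longrightarrow> v y \<le> r \<Longrightarrow> v (x * y) \<le> r"
  using abs_mult_le[of x 1 y r] by simp

lemma abs_inverse: "v (inverse x) = inverse (v x)"
proof (cases "x = 0")
  case False
  then have "v x * v (inverse x) = 1" by (simp add: abs_mult[symmetric] abs_1)
  then show ?thesis by (metis inverse_unique)
qed (simp add: abs_0)

lemma abs_eq_1_of_diff:
  assumes "v x = 1" "v (x - y) < 1"
  shows "v y = 1"
proof (rule antisym)
  show "v y \<le> 1" using abs_diff_le[of x 1 "x - y"] assms by simp
  show "1 \<le> v y" using abs_add[of y "x - y"] assms by auto
qed

text \<open>Additivity of the q-power map makes x^q - y^q equal to (x - y)^q; this is the source of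
  all contraction estimates.\<close>

lemma abs_frobenius_diff_le:
  assumes hom: "unital_ring_hom (\<lambda>x::'a. x ^ q)" and "v (x - y) \<le> r"
  shows "v (x ^ q - y ^ q) \<le> r ^ q"
proof -
  interpret frob: unital_ring_hom "\<lambda>x::'a. x ^ q" by (rule hom)
  show ?thesis
    using assms(2) abs_nonneg by (simp add: frob.hom_diff[symmetric] abs_power power_mono)
qed

text \<open>The difference of the products telescopes factor by factor, and the remaining factors
  have absolute value at most 1.\<close>

lemma abs_prod_diff_le:
  assumes "finite I" "0 \<le> r"
    and "\<And>i. i \<in> I \<Longrightarrow> v (f i) \<le> 1" "\<And>i. i \<in> I \<Longrightarrow> v (g i) \<le> 1" "\<And>i. i \<in> I \<Longrightarrow> v (f i - g i) \<le> r"
  shows "v (prod f I) \<le> 1 \<and> v (prod g I) \<le> 1 \<and> v (prod f I - prod g I) \<le> r"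
  using assms
proof (induction I rule: finite_induct)
  case (insert i I)
  then have IH: "v (prod f I) \<le> 1" "v (prod g I) \<le> 1" "v (prod f I - prod g I) \<le> r" by auto
  have "f i * prod f I - g i * prod g I = f i * (prod f I - prod g I) + prod g I * (f i - g i)"
    by (simp add: algebra_simps)
  also have "v \<dots> \<le> r"
    using insert IH by (intro abs_add_le abs_mult_le_right) auto
  finally show ?case
    using insert IH by (auto intro!: abs_mult_le_right)
qed (auto simp: abs_0 abs_1)

lemma abs_sign: "v (of_int (sign p)) = 1"
  by (auto simp: sign_def abs_1 abs_minus)

lemma abs_det_diff_le:
  fixes A B :: "'a^'n^'n"
  assumes "0 \<le> r" "\<And>i j. v (A $ i $ j) \<le> 1" "\<And>i j. v (B $ i $ j) \<le> 1"
    "\<And>i j. v (A $ i $ j - B $ i $ j) \<le> r"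
  shows "v (det A - det B) \<le> r"
proof -
  have "v (of_int (sign p) * (\<Prod>i\<in>UNIV. A $ i $ p i) - of_int (sign p) * (\<Prod>i\<in>UNIV. B $ i $ p i)) \<le> r"
    for p
  proof -
    have "v ((\<Prod>i\<in>UNIV. A $ i $ p i) - (\<Prod>i\<in>UNIV. B $ i $ p i)) \<le> r"
      using assms abs_prod_diff_le[of UNIV r "\<lambda>i. A $ i $ p i" "\<lambda>i. B $ i $ p i"] by simp
    then show ?thesis
      by (simp add: right_diff_distrib[symmetric] abs_mult abs_sign)
  qed
  then show ?thesis
    unfolding det_def sum_subtractf[symmetric] using assms(1) by (intro abs_sum_le)
qed

lemma max_norm_le_iff:
  fixes A :: "'a^'n^'m"
  shows "max_norm v A \<le> r \<longleftrightarrow> (\<forall>i j. v (A $ i $ j) \<le> r)"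
proof -
  have *: "{v (A $ i $ j) | i j. True} = (\<lambda>(i, j). v (A $ i $ j)) ` UNIV" by auto
  show ?thesis unfolding max_norm_def * by (subst Max_le_iff) auto
qed

end

locale complete_nonarch_field = nonarch_field v for v :: "'a::field \<Rightarrow> real" +
  assumes complete: "Metric_space.mcomplete UNIV (abs_dist v)"
begin

sublocale abs_metric: Metric_space UNIV "abs_dist v"
proof
  show "0 \<le> abs_dist v x y" for x y by (simp add: abs_dist_def abs_nonneg)
  show "abs_dist v x y = abs_dist v y x" for x y
    using abs_minus[of "x - y"] by (simp add: abs_dist_def)
  show "abs_dist v x y = 0 \<longleftrightarrow> x = y" for x y by (simp add: abs_dist_def abs_eq_0_iff)
  show "abs_dist v x z \<le> abs_dist v x y + abs_dist v y z" for x y z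
    using abs_add[of "x - y" "y - z"] abs_nonneg[of "x - y"] abs_nonneg[of "y - z"]
    by (simp add: abs_dist_def)
qed

text \<open>By the ultrametric inequality the whole tail is bounded by the bound for its first step,
  so passing to the limit loses no constant.\<close>

lemma geometric_limit:
  assumes r: "0 \<le> r" "r < 1" and step: "\<And>m. v (x (Suc m) - x m) \<le> r ^ Suc m"
  shows "\<exists>l. \<forall>m. v (l - x m) \<le> r ^ Suc m"
proof -
  have tail: "v (x (m + k) - x m) \<le> r ^ Suc m" for m k
  proof (induction k)
    case (Suc k)
    have "r ^ Suc (m + k) \<le> r ^ Suc m" using r by (intro power_decreasing) auto
    with step[of "m + k"] have "v (x (Suc (m + k)) - x (m + k)) \<le> r ^ Suc m" by linarith
    from abs_add_le[OF this Suc] show ?case by simp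
  qed (use r in \<open>simp add: abs_0\<close>)
  have tail': "v (x n - x m) \<le> r ^ Suc m" if "m \<le> n" for m n
    using tail[of m "n - m"] that by simp
  have lim0: "(\<lambda>m. r ^ Suc m) \<longlonglongrightarrow> 0"
    by (rule LIMSEQ_Suc[OF LIMSEQ_realpow_zero[OF r]])
  have "abs_metric.MCauchy x"
    unfolding abs_metric.MCauchy_def
  proof safe
    fix \<epsilon> :: real assume "\<epsilon> > 0"
    then have "eventually (\<lambda>m. r ^ Suc m < \<epsilon>) sequentially"
      using lim0 by (rule order_tendstoD(2)[rotated])
    then obtain N where N: "r ^ Suc N < \<epsilon>" by (meson eventually_sequentially order_refl)
    show "\<exists>N. \<forall>n n'. N \<le> n \<longrightarrow> N \<le> n' \<longrightarrow> abs_dist v (x n) (x n') < \<epsilon>"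
    proof (intro exI allI impI)
      fix n n' assume "N \<le> n" "N \<le> n'"
      then have "v ((x n - x N) - (x n' - x N)) \<le> r ^ Suc N" by (rule abs_diff_le[OF tail' tail'])
      with N show "abs_dist v (x n) (x n') < \<epsilon>" by (simp add: abs_dist_def)
    qed
  qed auto
  then obtain l where "limitin abs_metric.mtopology x l sequentially"
    using complete unfolding abs_metric.mcomplete_def by blast
  then have lim: "eventually (\<lambda>n. v (x n - l) < \<epsilon>) sequentially" if "\<epsilon> > 0" for \<epsilon>
    using that by (simp add: abs_metric.limitin_metric abs_dist_def)
  have "v (l - x m) \<le> r ^ Suc m" for m
  proof (rule field_le_epsilon)
    fix \<epsilon> :: real assume "\<epsilon> > 0"
    then obtain N where N: "\<And>n. n \<ge> N \<Longrightarrow> v (x n - l) < \<epsilon>"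
      using lim unfolding eventually_sequentially by blast
    define n where "n = max m N"
    have n: "v (x n - l) < \<epsilon>" "m \<le> n"
      using N by (auto simp: n_def)
    have "0 \<le> r ^ Suc m" using r by simp
    then have "v ((x n - x m) - (x n - l)) \<le> r ^ Suc m + \<epsilon>"
      using n tail'[OF n(2)] \<open>\<epsilon> > 0\<close> by (intro abs_diff_le[of "x n - x m"]) linarith+
    then show "v (l - x m) \<le> r ^ Suc m + \<epsilon>" by simp
  qed
  then show ?thesis by blast
qed

lemma exists_semilinear_fixed_point:
  fixes A B :: "'a^'n^'n"
  assumes hom: "unital_ring_hom (\<lambda>x::'a. x ^ q)" and q: "q > 1" and r: "0 \<le> r" "r < 1"
    and A: "\<And>i j. v (A $ i $ j) \<le> 1" and B: "\<And>i j. v (B $ i $ j) \<le> r"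
  shows "\<exists>U. U = A ** map_matrix (\<lambda>x. x ^ q) U + B \<and> (\<forall>i j. v (U $ i $ j) \<le> r)"
proof -
  define T where "T U = A ** map_matrix (\<lambda>x. x ^ q) U + B" for U :: "'a^'n^'n"
  define u where "u m = (T ^^ m) 0" for m
  have T_diff: "v (T U $ i $ j - T V $ i $ j) \<le> s ^ q"
    if "0 \<le> s" "\<And>i j. v (U $ i $ j - V $ i $ j) \<le> s" for U V :: "'a^'n^'n" and i j s
  proof -
    have "T U $ i $ j - T V $ i $ j = (\<Sum>k\<in>UNIV. A $ i $ k * (U $ k $ j ^ q - V $ k $ j ^ q))"
      by (simp add: T_def matrix_matrix_mult_def right_diff_distrib sum_subtractf)
    also have "v \<dots> \<le> s ^ q"
      using that A by (intro abs_sum_le abs_mult_le_right abs_frobenius_diff_le[OF hom]) auto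
    finally show ?thesis .
  qed
  \<comment> \<open>The q-power contraction becomes a geometric rate because m q >= 2 m >= m + 1.
    This fails for m = 0, where the first step is bounded by B instead.\<close>
  have pow: "(r ^ m) ^ q \<le> r ^ Suc m" if "m > 0" for m
  proof -
    have "m * 2 \<le> m * q" using q by (intro mult_le_mono) auto
    then have "Suc m \<le> m * q" using that by linarith
    then show ?thesis using r by (simp add: power_mult[symmetric] power_decreasing del: power_Suc)
  qed
  have step: "v (u (Suc m) $ i $ j - u m $ i $ j) \<le> r ^ Suc m" for m i j
  proof (induction m arbitrary: i j)
    case 0
    then show ?case using B q
      by (simp add: u_def T_def matrix_matrix_mult_def power_0_left)
  next
    case (Suc m)
    have "v (T (u (Suc m)) $ i $ j - T (u m) $ i $ j) \<le> (r ^ Suc m) ^ q"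
      using Suc r by (intro T_diff) auto
    then show ?case using pow[of "Suc m"] by (simp add: u_def)
  qed
  have "\<exists>l. \<forall>m. v (l - u m $ i $ j) \<le> r ^ Suc m" for i j
    using geometric_limit[OF r, of "\<lambda>m. u m $ i $ j"] step by blast
  then obtain l where l: "v (l i j - u m $ i $ j) \<le> r ^ Suc m" for i j m by metis
  define U where "U = (\<chi> i j. l i j)"
  have U: "v (U $ i $ j - u m $ i $ j) \<le> r ^ Suc m" for i j m unfolding U_def by (simp add: l del: power_Suc)
  \<comment> \<open>Both \<open>U\<close> and \<open>T U\<close> are within r^(m+1) of the iterate m
    + 1.\<close>
  have "v (U $ i $ j - T U $ i $ j) \<le> r ^ Suc m" for i j m
  proof -
    have le: "r ^ Suc (Suc m) \<le> r ^ Suc m" using r by (intro power_decreasing) auto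
    have "v (T U $ i $ j - T (u m) $ i $ j) \<le> (r ^ Suc m) ^ q"
      using U r by (intro T_diff) auto
    moreover have "T (u m) = u (Suc m)" by (simp add: u_def)
    ultimately have "v (T U $ i $ j - u (Suc m) $ i $ j) \<le> r ^ Suc m"
      using pow[of "Suc m"] le by (simp del: power_Suc)
    moreover have "v (U $ i $ j - u (Suc m) $ i $ j) \<le> r ^ Suc m"
      using U[of i j "Suc m"] le by linarith
    ultimately have "v ((U $ i $ j - u (Suc m) $ i $ j) - (T U $ i $ j - u (Suc m) $ i $ j)) \<le> r ^ Suc m"
      by (rule abs_diff_le[rotated])
    then show ?thesis by simp
  qed
  moreover have "(\<lambda>m. r ^ Suc m) \<longlonglongrightarrow> 0"
    by (rule LIMSEQ_Suc[OF LIMSEQ_realpow_zero[OF r]])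
  ultimately have "v (U $ i $ j - T U $ i $ j) \<le> 0" for i j
    by (intro LIMSEQ_le_const) auto
  then have "U $ i $ j = T U $ i $ j" for i j
    using abs_nonneg abs_eq_0_iff by (metis order_antisym eq_iff_diff_eq_0)
  then have "U = T U" by (simp add: vec_eq_iff)
  \<comment> \<open>The iteration starts at 0, so the limit estimate at m = 0 bounds
    \<open>U\<close> itself.\<close>
  moreover have "v (U $ i $ j) \<le> r" for i j using U[of i j 0] by (simp add: u_def)
  ultimately show ?thesis by (auto simp: T_def)
qed

end

subsection \<open>Invertible matrices over subrings\<close>

lemma matrix_add_rdistrib:
  fixes A B :: "'a::semiring_1^'m^'n" and C :: "'a^'p^'m"
  shows "(A + B) ** C = A ** C + B ** C"
  by (simp add: vec_eq_iff matrix_matrix_mult_def distrib_right sum.distrib)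

locale unital_subring =
  fixes R :: "'a::comm_ring_1 set"
  assumes one_mem: "1 \<in> R"
    and diff_mem: "x \<in> R \<Longrightarrow> y \<in> R \<Longrightarrow> x - y \<in> R"
    and mult_mem: "x \<in> R \<Longrightarrow> y \<in> R \<Longrightarrow> x * y \<in> R"
begin

lemma zero_mem: "0 \<in> R"
  using diff_mem[OF one_mem one_mem] by simp

lemma minus_mem: "x \<in> R \<Longrightarrow> - x \<in> R"
  using diff_mem[OF zero_mem] by simp

lemma add_mem: "x \<in> R \<Longrightarrow> y \<in> R \<Longrightarrow> x + y \<in> R"
  using diff_mem[OF _ minus_mem] by fastforce

lemma sum_mem: "(\<And>i. i \<in> I \<Longrightarrow> f i \<in> R) \<Longrightarrow> sum f I \<in> R"
  by (induction I rule: infinite_finite_induct) (auto simp: zero_mem add_mem)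

lemma prod_mem: "(\<And>i. i \<in> I \<Longrightarrow> f i \<in> R) \<Longrightarrow> prod f I \<in> R"
  by (induction I rule: infinite_finite_induct) (auto simp: one_mem mult_mem)

lemma det_mem:
  fixes A :: "'a^'n^'n"
  assumes "\<And>i j. A $ i $ j \<in> R"
  shows "det A \<in> R"
  unfolding det_def using assms
  by (intro sum_mem mult_mem prod_mem) (auto simp: sign_def one_mem minus_mem)

end

lemma GL_mono: "R \<subseteq> R' \<Longrightarrow> A \<in> GL R \<Longrightarrow> A \<in> GL R'"
  unfolding GL_def by blast

text \<open>By Cramer's rule the columns of the inverse are quotients by det A of determinants with
  entries in R.\<close>

lemma GL_of_inverse_det_mem:
  fixes A :: "'a::field^'n^'n"
  assumes R: "unital_subring R" and A: "\<And>i j. A $ i $ j \<in> R"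
    and det: "det A \<noteq> 0" "inverse (det A) \<in> R"
  shows "A \<in> GL R"
proof -
  interpret unital_subring R by (rule R)
  \<comment> \<open>\<open>M j k\<close> is A with column k replaced by the j-th unit
    vector.\<close>
  define M :: "'n \<Rightarrow> 'n \<Rightarrow> 'a^'n^'n" where
    "M j k = (\<chi> i l. if l = k then axis j 1 $ i else A $ i $ l)" for j k
  define B :: "'a^'n^'n" where "B = (\<chi> k j. det (M j k) / det A)"
  have "A *v (\<chi> k. det (M j k) / det A) = axis j 1" for j
    by (subst cramer[OF det(1)]) (simp add: M_def)
  then have "(\<Sum>k\<in>UNIV. A $ i $ k * B $ k $ j) = (if i = j then 1 else 0)" for i j
    by (auto simp: vec_eq_iff matrix_vector_mult_def axis_def B_def)
  then have AB: "A ** B = mat 1"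
    by (simp add: vec_eq_iff matrix_matrix_mult_def mat_def)
  have "M j k $ i $ l \<in> R" for j k i l
    using A by (auto simp: M_def axis_def one_mem zero_mem)
  then have "B $ k $ j \<in> R" for k j
    using det(2) by (simp add: B_def divide_inverse mult_mem det_mem)
  then show ?thesis
    using AB A matrix_left_right_inverse[of A B] unfolding GL_def by blast
qed

section \<open>Matrices over the valuation ring\<close>

context nonarch_field
begin

lemma unital_subring_valuation_ring: "unital_subring (valuation_ring v)"
  by unfold_locales
    (auto simp: valuation_ring_def abs_1 intro: abs_diff_le abs_mult_le_right)

lemma abs_matrix_mult_le:
  fixes A :: "'a^'m^'n" and B :: "'a^'p^'m"
  assumes "0 \<le> r" "\<And>i j. v (A $ i $ j) \<le> s" "\<And>i j. v (B $ i $ j) \<le> t" "s * t \<le> r"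
  shows "v ((A ** B) $ i $ j) \<le> r"
  unfolding matrix_matrix_mult_def using assms(1)
  by (auto intro!: abs_sum_le order_trans[OF abs_mult_le assms(4)] assms)

lemma GL_valuation_ring:
  fixes A :: "'a^'n^'n"
  assumes "\<And>i j. v (A $ i $ j) \<le> 1" "v (det A) = 1"
  shows "A \<in> GL (valuation_ring v)"
  using assms abs_0
  by (intro GL_of_inverse_det_mem unital_subring_valuation_ring)
    (auto simp: valuation_ring_def abs_inverse)

text \<open>Two reals in [0,1] with product 1 are both 1.\<close>

lemma abs_det_GL:
  fixes A :: "'a^'n^'n"
  assumes "A \<in> GL (valuation_ring v)"
  shows "v (det A) = 1"
proof -
  interpret O: unital_subring "valuation_ring v" by (rule unital_subring_valuation_ring)
  obtain B :: "'a^'n^'n" where AB: "\<And>i j. A $ i $ j \<in> valuation_ring v" "\<And>i j. B $ i $ j \<in> valuation_ring v"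
    "A ** B = mat 1"
    using assms by (auto simp: GL_def)
  have "v (det A) \<le> 1" "v (det B) \<le> 1"
    using O.det_mem AB by (auto simp: valuation_ring_def)
  moreover have "det A * det B = 1" using AB(3) by (metis det_I det_mul)
  then have "v (det A) * v (det B) = 1" by (metis abs_mult abs_1)
  ultimately show ?thesis
    using abs_nonneg by (metis mult_left_le order_antisym)
qed

text \<open>
  \<open>\<phi>(Y) = A\<^sup>-\<^sup>1 Y\<close> gives \<open>M\<^sup>q \<le> M\<close> for the norm \<open>M\<close> of a column of \<open>Y\<close>, and \<open>|det Y| = |det Y|\<^sup>q\<close>.
\<close>

lemma frobenius_fixed_integral:
  fixes A Y :: "'a^'n^'n"
  assumes q: "q > 1" and A: "A \<in> GL (valuation_ring v)"
    and Y: "invertible Y" "A ** map_matrix (\<lambda>x. x ^ q) Y = Y"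
    and hom: "unital_ring_hom (\<lambda>x::'a. x ^ q)"
  shows "v (Y $ i $ j) \<le> 1" and "v (det Y) = 1"
proof -
  interpret frob: unital_ring_hom "\<lambda>x::'a. x ^ q" by (rule hom)
  obtain B :: "'a^'n^'n" where B: "\<And>i j. v (B $ i $ j) \<le> 1" "B ** A = mat 1"
    using A by (auto simp: GL_def valuation_ring_def)
  have "map_matrix (\<lambda>x. x ^ q) Y = B ** Y"
    using B(2) Y(2) by (metis matrix_mul_assoc matrix_mul_lid)
  then have "Y $ i $ j ^ q = (\<Sum>k\<in>UNIV. B $ i $ k * Y $ k $ j)" for i j
    by (simp add: vec_eq_iff matrix_matrix_mult_def)
  then have le: "v (Y $ i $ j) ^ q \<le> s" if "0 \<le> s" "\<And>k. v (Y $ k $ j) \<le> s" for i j s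
    using that B by (auto simp: abs_power[symmetric] intro!: abs_sum_le abs_mult_le_right)
  define M where "M = Max (range (\<lambda>k. v (Y $ k $ j)))"
  have M_ge: "v (Y $ k $ j) \<le> M" for k by (simp add: M_def)
  have "M \<in> range (\<lambda>k. v (Y $ k $ j))" unfolding M_def by (intro Max_in) auto
  then obtain k where k: "M = v (Y $ k $ j)" by auto
  have "M ^ q \<le> M" using le[of M j k] M_ge k abs_nonneg by simp
  then have "M \<le> 1" using power_strict_increasing[of 1 q M] q by force
  then show "v (Y $ i $ j) \<le> 1" using M_ge[of i] by linarith
  have "det Y = det A * det Y ^ q" using Y(2) by (metis det_mul frob.hom_det)
  then have "v (det Y) = v (det Y) ^ q"
    using abs_det_GL[OF A] by (metis abs_mult abs_power mult_1)
  moreover have "v (det Y) > 0"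
    using Y(1) abs_nonneg[of "det Y"] by (simp add: invertible_det_nz abs_eq_0_iff less_le)
  ultimately show "v (det Y) = 1"
    using q power_strict_increasing[of 1 q "v (det Y)"] power_strict_decreasing[of 1 q "v (det Y)"]
    by (cases "v (det Y)" "1 :: real" rule: linorder_cases) auto
qed

end

text \<open>Let Z solve the equation for an approximation A' of A, and let P be its inverse. With Y
  = Z U the equation for A becomes (1 + E) \<phi>(U) = U, where E = P (A - A') \<phi>(Z).
  Integrality of Z and P keeps E as small as A - A'.\<close>

lemma (in complete_nonarch_field) lang_integral:
  fixes \<iota> :: "'b::alg_closed_field \<Rightarrow> 'a" and A :: "'a^'n^'n"
  assumes \<iota>: "field_embedding \<iota>" "extends_abs \<iota> u v" and u: "nonarch_abs u"
    and dense: "abs_metric.mtopology closure_of range \<iota> = UNIV"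
    and hom: "unital_ring_hom (\<lambda>x::'a. x ^ q)" and hom': "unital_ring_hom (\<lambda>x::'b. x ^ q)"
    and q: "q > 1" and A: "A \<in> GL (valuation_ring v)"
  shows "\<exists>Y :: 'a^'n^'n. (\<forall>i j. v (Y $ i $ j) \<le> 1) \<and> v (det Y) = 1 \<and>
    A ** map_matrix (\<lambda>x. x ^ q) Y = Y"
proof -
  interpret frob: unital_ring_hom "\<lambda>x::'a. x ^ q" by (rule hom)
  interpret emb: unital_ring_hom \<iota> using \<iota>(1) by (rule field_embedding_imp_hom)
  interpret u: nonarch_field u by unfold_locales (rule u)
  have emb_abs: "v (\<iota> x) = u x" for x using \<iota>(2) by (simp add: extends_abs_def)
  have A1: "v (A $ i $ j) \<le> 1" for i j using A by (simp add: GL_def valuation_ring_def)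
  have "\<exists>y. v (x - \<iota> y) < 1" for x
  proof -
    have "x \<in> abs_metric.mtopology closure_of range \<iota>" using dense by simp
    then have "\<exists>y\<in>range \<iota>. y \<in> abs_metric.mball x 1"
      unfolding abs_metric.metric_closure_of by (simp del: abs_metric.in_mball)
    then show ?thesis by (auto simp: abs_dist_def)
  qed
  then obtain \<kappa> where \<kappa>: "v (x - \<iota> (\<kappa> x)) < 1" for x by metis
  define A' where "A' = map_matrix \<kappa> A"
  \<comment> \<open>Being a maximum over finitely many entries, \<open>r\<close> stays strictly
    below 1.\<close>
  define r where "r = Max (range (\<lambda>(i, j). v (A $ i $ j - \<iota> (A' $ i $ j))))"
  have r_ge: "v (A $ i $ j - \<iota> (A' $ i $ j)) \<le> r" for i j
    unfolding r_def by (rule Max_ge) (auto intro: image_eqI[of _ _ "(i, j)"])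
  have "r \<in> range (\<lambda>(i, j). v (A $ i $ j - \<iota> (A' $ i $ j)))"
    unfolding r_def by (rule Max_in) auto
  then have r: "0 \<le> r" "r < 1" using \<kappa> abs_nonneg by (auto simp: A'_def)
  have \<iota>A1: "v (\<iota> (A' $ i $ j)) \<le> 1" for i j
    using abs_diff_le[OF A1[of i j], of "A $ i $ j - \<iota> (A' $ i $ j)"] r_ge[of i j] r by simp
  have "v (det A - det (map_matrix \<iota> A')) \<le> r"
    using A1 \<iota>A1 r_ge r by (intro abs_det_diff_le) auto
  then have "v (det (map_matrix \<iota> A')) = 1"
    using r abs_eq_1_of_diff[OF abs_det_GL[OF A], of "det (map_matrix \<iota> A')"] by simp
  then have A': "A' \<in> GL (valuation_ring u)"
    using \<iota>A1 by (intro u.GL_valuation_ring) (simp_all add: emb_abs emb.hom_det[symmetric])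
  then have "invertible A'" by (auto simp: GL_def invertible_def)
  then obtain Y' :: "'b^'n^'n" where Y': "invertible Y'" "A' ** map_matrix (\<lambda>x. x ^ q) Y' = Y'"
    using lang_exists[OF hom' q] by blast
  note Y'_integral = u.frobenius_fixed_integral[OF q A' Y' hom']
  define Z where "Z = map_matrix \<iota> Y'"
  define \<phi> :: "'a^'n^'n \<Rightarrow> 'a^'n^'n" where "\<phi> = map_matrix (\<lambda>x. x ^ q)"
  have \<iota>_pow: "\<iota> (x ^ n) = \<iota> x ^ n" for x n
    by (induction n) (auto simp: emb.hom_1 emb.hom_mult)
  have \<phi>_Z: "\<phi> Z = map_matrix \<iota> (map_matrix (\<lambda>x. x ^ q) Y')"
    by (simp add: \<phi>_def Z_def vec_eq_iff \<iota>_pow)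
  have Z: "map_matrix \<iota> A' ** \<phi> Z = Z"
    unfolding \<phi>_Z emb.hom_matrix_mult[symmetric] Y'(2) by (simp add: Z_def)
  have Z1: "v (Z $ i $ j) \<le> 1" for i j using Y'_integral by (simp add: Z_def emb_abs)
  have Z_det: "v (det Z) = 1" using Y'_integral by (simp add: Z_def emb.hom_det[symmetric] emb_abs)
  obtain P :: "'a^'n^'n" where P: "\<And>i j. v (P $ i $ j) \<le> 1" "Z ** P = mat 1" "P ** Z = mat 1"
    using GL_valuation_ring[OF Z1 Z_det] by (auto simp: GL_def valuation_ring_def)
  define E where "E = P ** (A - map_matrix \<iota> A') ** \<phi> Z"
  have \<phi>_Z1: "v (\<phi> Z $ i $ j) \<le> 1" for i j
    using Z1 abs_nonneg by (simp add: \<phi>_def abs_power power_le_one)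
  have "v ((P ** (A - map_matrix \<iota> A')) $ i $ j) \<le> r" for i j
    using P(1) r r_ge by (intro abs_matrix_mult_le[where s = 1 and t = r]) auto
  then have E: "v (E $ i $ j) \<le> r" for i j
    unfolding E_def using \<phi>_Z1 r by (intro abs_matrix_mult_le[where s = r and t = 1 and A = "P ** (A - map_matrix \<iota> A')"]) auto
  have "A - map_matrix \<iota> A' + map_matrix \<iota> A' = A" by simp
  then have "P ** A ** \<phi> Z = E + P ** (map_matrix \<iota> A' ** \<phi> Z)"
    unfolding E_def matrix_mul_assoc
    by (metis matrix_add_ldistrib matrix_add_rdistrib)
  then have PAZ: "P ** A ** \<phi> Z = mat 1 + E" by (simp add: Z P add.commute)
  have "v ((mat 1 + E) $ i $ j) \<le> 1" for i j
    using E[of i j] r by (auto simp: mat_def abs_1 abs_0 intro!: abs_add_le)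
  then obtain N :: "'a^'n^'n" where N: "N = (mat 1 + E) ** \<phi> N + E" "\<And>i j. v (N $ i $ j) \<le> r"
    using exists_semilinear_fixed_point[OF hom q r, of "mat 1 + E" E] E unfolding \<phi>_def by blast
  \<comment> \<open>Substituting U = 1 + N turns the homogeneous equation into the inhomogeneous one
    for N, whose solution is small. Hence det U is close to 1.\<close>
  define U where "U = mat 1 + N"
  have \<phi>_U: "\<phi> U = mat 1 + \<phi> N"
    by (simp add: U_def \<phi>_def frob.hom_matrix_add frob.hom_mat_1)
  have "(mat 1 + E) ** \<phi> U = mat 1 + ((mat 1 + E) ** \<phi> N + E)"
    by (simp add: \<phi>_U matrix_add_ldistrib algebra_simps)
  then have U: "(mat 1 + E) ** \<phi> U = U" by (simp add: N(1)[symmetric] U_def)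
  have U1: "v (U $ i $ j) \<le> 1" for i j
    using N(2)[of i j] r by (auto simp: U_def mat_def abs_1 abs_0 intro!: abs_add_le)
  have "v (det (mat 1 :: 'a^'n^'n) - det U) \<le> r"
    using U1 N(2) r by (intro abs_det_diff_le) (auto simp: U_def mat_def abs_1 abs_0 abs_minus)
  then have "v (det U) = 1"
    using r abs_eq_1_of_diff[of 1 "det U"] by (simp add: abs_1)
  then have det: "v (det (Z ** U)) = 1" by (simp add: det_mul abs_mult Z_det)
  have "A ** \<phi> (Z ** U) = Z ** P ** A ** \<phi> Z ** \<phi> U"
    by (simp add: P \<phi>_def frob.hom_matrix_mult matrix_mul_assoc)
  also have "\<dots> = Z ** ((P ** A ** \<phi> Z) ** \<phi> U)" by (simp only: matrix_mul_assoc)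
  also have "\<dots> = Z ** U" by (simp add: PAZ U)
  finally show ?thesis
    using det Z1 U1 unfolding \<phi>_def
    by (intro exI[of _ "Z ** U"]) (auto intro!: abs_matrix_mult_le[where s = 1 and t = 1])
qed

subsection \<open>Power series with geometrically decaying coefficients\<close>

lemma unital_ring_hom_fps_to_fls: "unital_ring_hom (fps_to_fls :: 'a::comm_ring_1 fps \<Rightarrow> 'a fls)"
  by unfold_locales (auto simp: fls_times_fps_to_fls)

lemma unital_ring_hom_fps_nth_0: "unital_ring_hom (\<lambda>f :: 'a::comm_ring_1 fps. fps_nth f 0)"
  by unfold_locales (auto simp: fps_mult_nth)

text \<open>For 0 <= \<delta> < 1 this ring lies both in the power series over the valuation ring
  and in the Tate algebra, so invertibility over it settles both claims about Y. Since 0^0 = 1, the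
  case \<delta> = 0 gives the integral constants.\<close>

definition geometric_fps :: "('a::field \<Rightarrow> real) \<Rightarrow> real \<Rightarrow> 'a fps set" where
  "geometric_fps v \<delta> = {f. \<forall>l. v (fps_nth f l) \<le> \<delta> ^ l}"

context nonarch_field
begin

lemma geometric_conv_le:
  assumes "0 \<le> \<delta>" and "i \<le> l" "v x \<le> \<delta> ^ i" "v y \<le> \<delta> ^ (l - i)"
  shows "v (x * y) \<le> \<delta> ^ l"
  using abs_mult_le[OF assms(3,4)] assms(2) by (simp add: power_add[symmetric])

lemma unital_subring_geometric_fps:
  assumes "0 \<le> \<delta>"
  shows "unital_subring (geometric_fps v \<delta>)"
proof
  fix f g assume fg: "f \<in> geometric_fps v \<delta>" "g \<in> geometric_fps v \<delta>"
  show "f - g \<in> geometric_fps v \<delta>"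
    using fg by (auto simp: geometric_fps_def intro: abs_diff_le)
  show "f * g \<in> geometric_fps v \<delta>"
    unfolding geometric_fps_def fps_mult_nth mem_Collect_eq
  proof (intro allI abs_sum_le)
    show "v (fps_nth f i * fps_nth g (l - i)) \<le> \<delta> ^ l" if "i \<in> {0..l}" for i l
      using that fg by (intro geometric_conv_le[OF assms, of i]) (auto simp: geometric_fps_def)
  qed (use assms in auto)
qed (use assms in \<open>auto simp: geometric_fps_def abs_1 abs_0 fps_one_nth\<close>)

text \<open>Comparing coefficients in f * inverse f = 1 expresses each coefficient of the inverse
  through earlier ones; the division by the constant term of f does not change absolute
  values.\<close>

lemma inverse_geometric_fps:
  assumes "0 \<le> \<delta>" and f: "f \<in> geometric_fps v \<delta>" "v (fps_nth f 0) = 1"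
  shows "inverse f \<in> geometric_fps v \<delta>"
proof -
  have f0: "fps_nth f 0 \<noteq> 0" using f(2) abs_0 by auto
  have "v (fps_nth (inverse f) l) \<le> \<delta> ^ l" for l
  proof (induction l rule: less_induct)
    case (less l)
    show ?case
    proof (cases "l = 0")
      case True
      then show ?thesis using f(2) by (simp add: abs_inverse)
    next
      case False
      let ?s = "\<Sum>i = 1..l. fps_nth f i * fps_nth (inverse f) (l - i)"
      have "(\<Sum>i = 0..l. fps_nth f i * fps_nth (inverse f) (l - i)) = fps_nth (f * inverse f) l"
        by (simp add: fps_mult_nth)
      also have "\<dots> = 0" using False f0 by (simp add: inverse_mult_eq_1')
      finally have "fps_nth f 0 * fps_nth (inverse f) l + ?s = 0"
        by (simp add: sum.atLeast_Suc_atMost)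
      then have "fps_nth f 0 * fps_nth (inverse f) l = - ?s" by (simp add: eq_neg_iff_add_eq_0)
      then have "v (fps_nth f 0 * fps_nth (inverse f) l) = v ?s" by (simp add: abs_minus)
      also have "\<dots> \<le> \<delta> ^ l"
        using f(1) assms(1) less
        by (intro abs_sum_le geometric_conv_le[OF assms(1)]) (auto simp: geometric_fps_def)
      finally show ?thesis by (simp add: abs_mult f(2))
    qed
  qed
  then show ?thesis by (simp add: geometric_fps_def)
qed

text \<open>The determinant is a unit because its constant term is det Y_0. Cramer's rule is applied
  in the field of Laurent series, and the inverse is pulled back along the injective
  \<open>fps_to_fls\<close>.\<close>

lemma GL_geometric_fps:
  fixes Y :: "'a fps^'n^'n"
  assumes \<delta>: "0 \<le> \<delta>" and Y: "\<And>i j. Y $ i $ j \<in> geometric_fps v \<delta>"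
    and det: "v (det (mat_coeff Y 0)) = 1"
  shows "Y \<in> GL (geometric_fps v \<delta>)"
    and "map_matrix fps_to_fls Y \<in> GL (fps_to_fls ` geometric_fps v \<delta>)"
proof -
  let ?G = "geometric_fps v \<delta>"
  let ?L = "fps_to_fls :: 'a fps \<Rightarrow> 'a fls"
  interpret G: unital_subring ?G by (rule unital_subring_geometric_fps[OF \<delta>])
  interpret L: unital_ring_hom ?L by (rule unital_ring_hom_fps_to_fls)
  interpret coeff0: unital_ring_hom "\<lambda>f :: 'a fps. fps_nth f 0"
    by (rule unital_ring_hom_fps_nth_0)
  have R: "unital_subring (?L ` ?G)"
  proof
    show "1 \<in> ?L ` ?G" using G.one_mem by (metis image_eqI fps_one_to_fls)
    fix x y assume "x \<in> ?L ` ?G" "y \<in> ?L ` ?G"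
    then show "x - y \<in> ?L ` ?G" "x * y \<in> ?L ` ?G"
      by (auto simp flip: fps_to_fls_minus fls_times_fps_to_fls intro!: imageI G.diff_mem G.mult_mem)
  qed
  have "v (fps_nth (det Y) 0) = 1"
    using det by (simp add: coeff0.hom_det mat_coeff_def)
  moreover from this have "fps_nth (det Y) 0 \<noteq> 0" using abs_0 by auto
  ultimately have "det Y \<noteq> 0" "inverse (?L (det Y)) = ?L (inverse (det Y))" "inverse (det Y) \<in> ?G"
    using \<delta> Y by (auto simp: fls_inverse_fps_to_fls subdegree_eq_0_iff intro!: inverse_geometric_fps G.det_mem)
  then show GL: "map_matrix ?L Y \<in> GL (?L ` ?G)"
    using Y by (intro GL_of_inverse_det_mem R) (auto simp flip: L.hom_det)
  then obtain B :: "'a fls^'n^'n" where B: "\<And>i j. B $ i $ j \<in> ?L ` ?G"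
      "map_matrix ?L Y ** B = mat 1" "B ** map_matrix ?L Y = mat 1"
    by (auto simp: GL_def)
  have "\<exists>c. c \<in> ?G \<and> B $ i $ j = ?L c" for i j using B(1) by blast
  then obtain c where c: "c i j \<in> ?G" "B $ i $ j = ?L (c i j)" for i j by metis
  define C where "C = (\<chi> i j. c i j)"
  have "B = map_matrix ?L C" by (simp add: vec_eq_iff C_def c)
  then have "map_matrix ?L (Y ** C) = map_matrix ?L (mat 1)" "map_matrix ?L (C ** Y) = map_matrix ?L (mat 1)"
    using B by (simp_all add: L.hom_matrix_mult L.hom_mat_1)
  then have "Y ** C = mat 1" "C ** Y = mat 1" by (simp_all add: vec_eq_iff)
  then show "Y \<in> GL ?G" using Y c(1) unfolding GL_def C_def
    by (auto intro!: exI[of _ "\<chi> i j. c i j"])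
qed

lemma geometric_fps_subset:
  assumes "0 \<le> \<delta>" "\<delta> < 1"
  shows "geometric_fps v \<delta> \<subseteq> fps_over (valuation_ring v)"
    and "fps_to_fls ` geometric_fps v \<delta> \<subseteq> tate_quot v"
proof -
  have "\<delta> ^ l \<le> 1" for l using assms by (simp add: power_le_one)
  then show "geometric_fps v \<delta> \<subseteq> fps_over (valuation_ring v)"
    unfolding geometric_fps_def fps_over_def valuation_ring_def using order_trans by blast
  have tate: "f \<in> tate_algebra v" if "f \<in> geometric_fps v \<delta>" for f
    unfolding tate_algebra_def mem_Collect_eq
  proof (rule tendsto_sandwich[where f = "\<lambda>_. 0"])
    show "(\<lambda>l. \<delta> ^ l) \<longlonglongrightarrow> 0" using assms by (rule LIMSEQ_realpow_zero)
  qed (use that abs_nonneg in \<open>auto simp: geometric_fps_def\<close>)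
  \<comment> \<open>The unit serves as the denominator in \<open>tate_quot\<close>.\<close>
  have "1 \<in> tate_algebra v"
    using assms by (intro tate unital_subring.one_mem[OF unital_subring_geometric_fps])
  then have "fps_to_fls f \<in> tate_quot v" if "f \<in> geometric_fps v \<delta>" for f
    using tate[OF that] unfolding tate_quot_def mem_Collect_eq
    by (intro exI[of _ f] exI[of _ 1]) auto
  then show "fps_to_fls ` geometric_fps v \<delta> \<subseteq> tate_quot v" by blast
qed

end

section \<open>Solving for the coefficients of Y\<close>

context complete_nonarch_field
begin

text \<open>The unknown Y_l also occurs on the right, in the summand i = 0, so each stage is a fixed
  point problem. Contraction needs \<delta>^l < 1, hence Y_0 has to be given in advance.\<close>

lemma exists_frobenius_recursion:
  fixes D :: "nat \<Rightarrow> 'a^'n^'n" and Y0 :: "'a^'n^'n"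
  assumes hom: "unital_ring_hom (\<lambda>x::'a. x ^ q)" and q: "q > 1" and \<delta>: "0 \<le> \<delta>" "\<delta> < 1"
    and D: "\<And>l i j. v (D l $ i $ j) \<le> \<delta> ^ l"
    and Y0: "\<And>i j. v (Y0 $ i $ j) \<le> 1" "D 0 ** map_matrix (\<lambda>x. x ^ q) Y0 = Y0"
  shows "\<exists>Y. Y 0 = Y0 \<and> (\<forall>l i j. v (Y l $ i $ j) \<le> \<delta> ^ l) \<and>
    (\<forall>l. Y l = (\<Sum>i\<le>l. D i ** map_matrix (\<lambda>x. x ^ q) (Y (l - i))))"
proof -
  define \<phi> :: "'a^'n^'n \<Rightarrow> 'a^'n^'n" where "\<phi> = map_matrix (\<lambda>x. x ^ q)"
  define rest where "rest Y l = (\<Sum>i=1..l. D i ** \<phi> (Y (l - i)))" for Y l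
  define P where "P Y l Z \<longleftrightarrow> (\<forall>i j. v (Z $ i $ j) \<le> \<delta> ^ l) \<and>
    (if l = 0 then Z = Y0 else Z = D 0 ** \<phi> Z + rest Y l)" for Y l and Z :: "'a^'n^'n"
  have "\<exists>Y. \<forall>l. P Y l (Y l)"
  \<comment> \<open>\<open>P Y l\<close> consults Y only below l, because the sum in
    \<open>rest\<close> starts at i = 1.\<close>
  proof (rule dependent_wellorder_choice)
    fix r and f g :: "nat \<Rightarrow> 'a^'n^'n" and l :: nat
    assume "\<And>y. y < l \<Longrightarrow> f y = g y"
    then have "rest f l = rest g l" unfolding rest_def by (intro sum.cong) auto
    then show "P f l r = P g l r" by (simp add: P_def)
  next
    fix l and Y :: "nat \<Rightarrow> 'a^'n^'n"
    assume IH: "\<And>y. y < l \<Longrightarrow> P Y y (Y y)"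
    show "\<exists>r. P Y l r"
    proof (cases "l = 0")
      case True
      then show ?thesis using Y0 by (auto simp: P_def)
    next
      case False
      have "v ((D m ** \<phi> (Y (l - m))) $ i $ j) \<le> \<delta> ^ l" if "m \<in> {1..l}" for m i j
      proof (rule abs_matrix_mult_le[OF _ D, where t = "\<delta> ^ (l - m)"])
        show "\<delta> ^ m * \<delta> ^ (l - m) \<le> \<delta> ^ l" using that by (simp add: power_add[symmetric])
        fix i j
        have "v (Y (l - m) $ i $ j) \<le> \<delta> ^ (l - m)" using IH[of "l - m"] that by (simp add: P_def)
        moreover have "\<delta> ^ (l - m) \<le> 1" using \<delta> by (simp add: power_le_one)
        \<comment> \<open>On the unit ball the q-power map does not increase absolute values, so the
          bound on Y_(l-m) passes to its image.\<close>
        ultimately have "v (Y (l - m) $ i $ j) ^ q \<le> v (Y (l - m) $ i $ j) ^ 1"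
          using q abs_nonneg by (intro power_decreasing) auto
        with \<open>v (Y (l - m) $ i $ j) \<le> \<delta> ^ (l - m)\<close>
        show "v (\<phi> (Y (l - m)) $ i $ j) \<le> \<delta> ^ (l - m)"
          by (simp add: \<phi>_def abs_power)
      qed (use \<delta> in auto)
      then have "v (rest Y l $ i $ j) \<le> \<delta> ^ l" for i j
        using \<delta> by (auto simp: rest_def sum_component intro!: abs_sum_le)
      moreover have "\<delta> ^ l < 1" using \<delta> False by (simp add: power_less_one_iff)
      ultimately obtain Z :: "'a^'n^'n" where "Z = D 0 ** \<phi> Z + rest Y l" "\<forall>i j. v (Z $ i $ j) \<le> \<delta> ^ l"
        using exists_semilinear_fixed_point[OF hom q, of "\<delta> ^ l" "D 0" "rest Y l"] \<delta> D[of 0]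
        unfolding \<phi>_def by auto
      then show ?thesis using False unfolding P_def by auto
    qed
  qed
  then obtain Y where Y: "\<And>l. P Y l (Y l)" by blast
  have eq: "Y l = (\<Sum>i\<le>l. D i ** \<phi> (Y (l - i)))" for l
  proof (cases "l = 0")
    case True
    then show ?thesis using Y[of 0] Y0 by (simp add: P_def \<phi>_def)
  next
    case False
    then have "Y l = D 0 ** \<phi> (Y l) + rest Y l" using Y[of l] by (simp add: P_def)
    also have "\<dots> = (\<Sum>i=0..l. D i ** \<phi> (Y (l - i)))"
      by (simp add: rest_def sum.atLeast_Suc_atMost)
    finally show ?thesis by (simp add: atMost_atLeast0)
  qed
  have "Y 0 = Y0" "\<forall>l i j. v (Y l $ i $ j) \<le> \<delta> ^ l" using Y by (auto simp: P_def)
  with eq show ?thesis unfolding \<phi>_def by blast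
qed

end

section \<open>From the coefficient recursion to the equation over Laurent series\<close>

lemma phi_fps_to_fls:
  assumes "q > 0"
  shows "phi q (fps_to_fls f) = fps_to_fls (Abs_fps (\<lambda>n. fps_nth f n ^ q))"
  using assms by (intro fls_eqI) (simp add: fls_nth_phi)

text \<open>Taking constant terms is a ring homomorphism, so it carries the inverse along.\<close>

lemma mat_coeff_0_GL:
  fixes D :: "'a::field fps^'n^'n"
  assumes "D \<in> GL (fps_over R)"
  shows "mat_coeff D 0 \<in> GL R"
proof -
  interpret coeff0: unital_ring_hom "\<lambda>f :: 'a fps. fps_nth f 0"
    by (rule unital_ring_hom_fps_nth_0)
  obtain B :: "'a fps^'n^'n" where B: "\<And>i j. B $ i $ j \<in> fps_over R" "D ** B = mat 1" "B ** D = mat 1"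
    using assms by (auto simp: GL_def)
  have "mat_coeff D 0 ** mat_coeff B 0 = mat 1" "mat_coeff B 0 ** mat_coeff D 0 = mat 1"
    by (simp_all add: mat_coeff_def coeff0.hom_matrix_mult[symmetric] B coeff0.hom_mat_1)
  moreover have "mat_coeff D 0 $ i $ j \<in> R" "mat_coeff B 0 $ i $ j \<in> R" for i j
    using assms B(1) by (auto simp: mat_coeff_def GL_def fps_over_def)
  ultimately show ?thesis unfolding GL_def by blast
qed

lemma frobenius_equation_of_recursion:
  fixes D Y :: "'a::field fps^'n^'n"
  assumes q: "q > 0"
    and rec: "\<And>l. mat_coeff Y l =
      (\<Sum>i\<le>l. mat_coeff D i ** map_matrix (\<lambda>x. x ^ q) (mat_coeff Y (l - i)))"
  shows "map_matrix fps_to_fls D ** map_matrix (phi q) (map_matrix fps_to_fls Y) = map_matrix fps_to_fls Y"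
proof -
  interpret L: unital_ring_hom "fps_to_fls :: 'a fps \<Rightarrow> 'a fls" by (rule unital_ring_hom_fps_to_fls)
  \<comment> \<open>\<open>F\<close> is the image of Y under the coefficientwise q-power map, kept
    as a power series so that the product with D is a Cauchy product.\<close>
  define F where "F = map_matrix (\<lambda>f. Abs_fps (\<lambda>n. fps_nth f n ^ q)) Y"
  have "map_matrix (phi q) (map_matrix fps_to_fls Y) = map_matrix fps_to_fls F"
    using q by (simp add: F_def vec_eq_iff phi_fps_to_fls)
  moreover have "fps_nth ((D ** F) $ i $ j) l = fps_nth (Y $ i $ j) l" for i j l
  proof -
    have "fps_nth (Y $ i $ j) l = mat_coeff Y l $ i $ j" by (simp add: mat_coeff_def)
    also have "\<dots> = (\<Sum>m\<le>l. \<Sum>k\<in>UNIV. fps_nth (D $ i $ k) m * fps_nth (Y $ k $ j) (l - m) ^ q)"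
      by (subst rec) (simp add: sum_component matrix_matrix_mult_def mat_coeff_def)
    also have "\<dots> = (\<Sum>k\<in>UNIV. \<Sum>m\<le>l. fps_nth (D $ i $ k) m * fps_nth (Y $ k $ j) (l - m) ^ q)"
      by (rule sum.swap)
    also have "\<dots> = fps_nth ((D ** F) $ i $ j) l"
      by (simp add: matrix_matrix_mult_def fps_sum_nth fps_mult_nth F_def atMost_atLeast0)
    finally show ?thesis ..
  qed
  then have "D ** F = Y" by (simp add: vec_eq_iff fps_eq_iff)
  ultimately show ?thesis by (simp add: L.hom_matrix_mult[symmetric])
qed

theorem theorem4p3:
  fixes q :: nat
    and Fq :: "'k::field set"
    and \<iota>\<^sub>1 :: "'k \<Rightarrow> 'k1::field" and \<iota>\<^sub>2 :: "'k1 \<Rightarrow> 'k2::alg_closed_field" and \<iota>\<^sub>3 :: "'k2 \<Rightarrow> 'K::field"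
    and v :: "'k \<Rightarrow> real" and v\<^sub>1 :: "'k1 \<Rightarrow> real" and v\<^sub>2 :: "'k2 \<Rightarrow> real" and w :: "'K \<Rightarrow> real"
    and D :: "'K fps^'n^'n"
    and \<delta> :: real
  assumes "primepow q"
    and "is_subfield Fq" and "card Fq = q"
    and "nonarch_abs v" and "nontrivial_abs v"
    and "completed_algebraic_closure \<iota>\<^sub>1 \<iota>\<^sub>2 \<iota>\<^sub>3 v v\<^sub>1 v\<^sub>2 w"
    and "D \<in> GL (fps_over (valuation_ring w))"
    and "\<delta> < 1" and "\<And>l. max_norm w (mat_coeff D l) \<le> \<delta> ^ l"
  shows "\<exists>Y :: 'K fps^'n^'n.
           Y \<in> GL (fps_over (valuation_ring w)) \<and>
           (\<forall>l. max_norm w (mat_coeff Y l) \<le> \<delta> ^ l) \<and>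
           fundamental_matrix w q (map_matrix fps_to_fls D) (map_matrix fps_to_fls Y)"
proof -
  have emb: "field_embedding \<iota>\<^sub>1" "field_embedding \<iota>\<^sub>2" "field_embedding \<iota>\<^sub>3"
    and v\<^sub>2: "nonarch_abs v\<^sub>2" and w: "nonarch_abs w" "extends_abs \<iota>\<^sub>3 v\<^sub>2 w"
      "Metric_space.mcomplete UNIV (abs_dist w)"
      "Metric_space.mtopology UNIV (abs_dist w) closure_of range \<iota>\<^sub>3 = UNIV"
    using assms(6)
    by (auto simp: completed_algebraic_closure_def is_completion_def is_algebraic_closure_def)
  interpret complete_nonarch_field w
    by (intro_locales; unfold_locales) (fact w)+
  have q: "q > 1" using primepow_gt_Suc_0[OF assms(1)] by simp
  \<comment> \<open>The vanishing of q is counted in the finite subfield and carried up the tower,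
    which makes the q-power map additive on both upper fields.\<close>
  have "of_nat q = (0 :: 'k)" using of_nat_card_subfield[OF assms(2)] assms(3) q by simp
  then have "of_nat q = (0 :: 'k1)"
    using field_embedding_imp_hom[OF emb(1)] by (metis unital_ring_hom.hom_of_nat unital_ring_hom.hom_0)
  then have k2: "of_nat q = (0 :: 'k2)"
    using field_embedding_imp_hom[OF emb(2)] by (metis unital_ring_hom.hom_of_nat unital_ring_hom.hom_0)
  then have K: "of_nat q = (0 :: 'K)"
    using field_embedding_imp_hom[OF emb(3)] by (metis unital_ring_hom.hom_of_nat unital_ring_hom.hom_0)
  have hom: "unital_ring_hom (\<lambda>x::'K. x ^ q)" and hom': "unital_ring_hom (\<lambda>x::'k2. x ^ q)"
    using primepow_power_hom[OF assms(1)] k2 K by auto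
  have D: "w (mat_coeff D l $ i $ j) \<le> \<delta> ^ l" for l i j
    using assms(9) by (simp add: max_norm_le_iff)
  \<comment> \<open>Nonnegativity comes from the bound on D_1, as the exponent there is 1.\<close>
  have \<delta>: "0 \<le> \<delta>" "\<delta> < 1"
    using order_trans[OF abs_nonneg D[of 1]] assms(8) by auto
  have D0: "mat_coeff D 0 \<in> GL (valuation_ring w)"
    using assms(7) by (rule mat_coeff_0_GL)
  obtain Y0 :: "'K^'n^'n" where Y0: "\<And>i j. w (Y0 $ i $ j) \<le> 1" "w (det Y0) = 1"
      "mat_coeff D 0 ** map_matrix (\<lambda>x. x ^ q) Y0 = Y0"
    using lang_integral[OF emb(3) w(2) v\<^sub>2 w(4) hom hom' q D0] by blast
  obtain Ys :: "nat \<Rightarrow> 'K^'n^'n" where Ys: "Ys 0 = Y0" "\<And>l i j. w (Ys l $ i $ j) \<le> \<delta> ^ l"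
      "\<And>l. Ys l = (\<Sum>i\<le>l. mat_coeff D i ** map_matrix (\<lambda>x. x ^ q) (Ys (l - i)))"
    using exists_frobenius_recursion[OF hom q \<delta> D Y0(1,3)] by blast
  define Y :: "'K fps^'n^'n" where "Y = (\<chi> i j. Abs_fps (\<lambda>l. Ys l $ i $ j))"
  have coeff: "mat_coeff Y l = Ys l" for l by (simp add: mat_coeff_def Y_def vec_eq_iff)
  have "Y $ i $ j \<in> geometric_fps w \<delta>" for i j
    using Ys(2) by (simp add: geometric_fps_def Y_def)
  then have "Y \<in> GL (geometric_fps w \<delta>)"
    "map_matrix fps_to_fls Y \<in> GL (fps_to_fls ` geometric_fps w \<delta>)"
    using Y0(2) by (auto intro!: GL_geometric_fps[OF \<delta>(1)] simp: coeff Ys(1))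
  then have "Y \<in> GL (fps_over (valuation_ring w))" "map_matrix fps_to_fls Y \<in> GL (tate_quot w)"
    using geometric_fps_subset[OF \<delta>] by (auto intro: GL_mono)
  moreover have "map_matrix fps_to_fls D ** map_matrix (phi q) (map_matrix fps_to_fls Y) =
      map_matrix fps_to_fls Y"
    using q by (intro frobenius_equation_of_recursion) (simp, unfold coeff, rule Ys(3))
  ultimately show ?thesis
    using Ys(2) by (intro exI[of _ Y]) (simp add: fundamental_matrix_def max_norm_le_iff coeff)
qed

end
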